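(* Let $\mathcal R_1$ be the random unequal crossover recombinator on $\mathcal M_1^+$, $$\mathcal R_1(p)_i=\sum_{\substack{k,\ell\ge0\\ k+\ell\ge i}}\frac{1+\min\{k,\ell,i,k+\ell-i\}}{(k+1)(\ell+1)}\,p_k\,p_\ell,\qquad i\in\mathbb N_0 .$$ Let $p(0)\in\mathcal M_1^+$ satisfy $\limsup_{k\to\infty}\sqrt[k]{p_k(0)}<1$, and let $m=\sum_{k\ge0}k\,p_k(0)$. Then, both for the discrete-time dynamics $p(t+1)=\mathcal R_1(p(t))$, $t\in\mathbb N_0$, and for the continuous-time dynamics $\frac{d}{dt}p(t)=\mathcal R_1(p(t))-p(t)$, $t\ge0$, one has $\lim_{t\to\infty}\|p(t)-p\|_1=0$, where $$p_k=\Big(\frac{2}{m+2}\Big)^2(k+1)\Big(\frac{m}{m+2}\Big)^k,\qquad k\in\mathbb N_0 .$$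
   Context: $\mathcal M_1^+$ denotes the set of probability measures on $\mathbb N_0$, identified with nonnegative sequences $p=(p_k)_{k\ge0}$ with $\sum_k p_k=1$, viewed inside $\ell^1(\mathbb N_0)$ with norm $\|x\|_1=\sum_k|x_k|$. The continuous-time equation is an ODE in $\ell^1(\mathbb N_0)$ with initial value $p(0)$. *)

theory Defs
  imports "HOL-Analysis.Analysis"
begin

definition prob_seq :: "(nat \<Rightarrow> real) \<Rightarrow> bool" where
  "prob_seq p \<longleftrightarrow> (\<forall>k. 0 \<le> p k) \<and> summable p \<and> (\<Sum>k. p k) = 1"

definition in_l1 :: "(nat \<Rightarrow> real) \<Rightarrow> bool" where
  "in_l1 x \<longleftrightarrow> summable (\<lambda>k. \<bar>x k\<bar>)"

definition l1norm :: "(nat \<Rightarrow> real) \<Rightarrow> real" where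
  "l1norm x = (\<Sum>k. \<bar>x k\<bar>)"

definition R1 :: "(nat \<Rightarrow> real) \<Rightarrow> nat \<Rightarrow> real" where
  "R1 p i = (\<Sum>\<^sub>\<infinity>(k, l) \<in> {(k, l). i \<le> k + l}.
      (1 + real (min (min k l) (min i (k + l - i)))) / (real (k + 1) * real (l + 1)) * p k * p l)"

definition has_l1_derivative :: "(real \<Rightarrow> nat \<Rightarrow> real) \<Rightarrow> (nat \<Rightarrow> real) \<Rightarrow> real \<Rightarrow> bool" where
  "has_l1_derivative P D t \<longleftrightarrow>
     ((\<lambda>s. l1norm (\<lambda>k. (P s k - P t k) / (s - t) - D k)) \<longlongrightarrow> 0) (at t within {0..})"

definition limit_dist :: "real \<Rightarrow> nat \<Rightarrow> real" where
  "limit_dist m k = (2 / (m + 2))\<^sup>2 * real (k + 1) * (m / (m + 2)) ^ k"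

end

theory Submission
  imports Defs
begin

text \<open>If \<open>p\<close> has generating function \<open>\<phi>\<close>, then \<open>R1 p\<close> has generating function \<open>(A \<phi>)\<^sup>2\<close>, where
  \<open>A \<phi> z\<close> is the average of \<open>\<phi>\<close> over \<open>[z, 1]\<close>: an unequal crossover of \<open>k\<close> and \<open>l\<close> is the sum of
  independent uniform variables on \<open>{0..k}\<close> and \<open>{0..l}\<close>. Averaging divides a bound of the form
  \<open>D (1 - z)\<^sup>2\<close> by 3 and squaring at most doubles differences of functions with values in \<open>[0, 1]\<close>,
  so \<open>R1\<close> is a contraction with factor 2/3 for the distance \<open>sup \<bar>\<phi> z - \<psi> z\<bar> / (1 - z)\<^sup>2\<close>. This
  distance is finite for laws with equal mean and finite second moments, and the negative binomial
  law \<open>limit_dist m\<close> is a fixed point. Convergence of the generating functions on \<open>(0, 1)\<close> gives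
  convergence of the coefficients, hence in \<open>l1\<close> because all masses are 1.

  In continuous time the solution must first be shown to stay a probability vector. Both this and
  the contraction estimate are obtained by comparing with \<open>(c t)^n / n!\<close> and induction on \<open>n\<close>,
  which replaces Gronwall's inequality for quantities not known to be differentiable or finite.\<close>

lemma in_l1_imp_summable: "in_l1 x \<Longrightarrow> summable x"
  unfolding in_l1_def by (rule summable_rabs_cancel)

lemma in_l1_mult:
  assumes "in_l1 x" "\<And>k. \<bar>w k\<bar> \<le> 1"
  shows "in_l1 (\<lambda>k. w k * x k)"
  unfolding in_l1_def
proof (rule summable_comparison_test'[where N = 0])
  show "summable (\<lambda>k. \<bar>x k\<bar>)"
    using assms(1) by (simp add: in_l1_def)
  show "norm \<bar>w k * x k\<bar> \<le> \<bar>x k\<bar>" for k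
    using mult_right_mono[OF assms(2)[of k], of "\<bar>x k\<bar>"] by (simp add: abs_mult)
qed

lemma in_l1_diff:
  assumes "in_l1 x" "in_l1 y"
  shows "in_l1 (\<lambda>k. x k - y k)"
  unfolding in_l1_def
proof (rule summable_comparison_test'[where N = 0])
  show "summable (\<lambda>k. \<bar>x k\<bar> + \<bar>y k\<bar>)"
    using assms by (intro summable_add) (auto simp: in_l1_def)
  show "norm \<bar>x k - y k\<bar> \<le> \<bar>x k\<bar> + \<bar>y k\<bar>" for k
    by simp
qed

lemma in_l1_cmult: "in_l1 x \<Longrightarrow> in_l1 (\<lambda>k. c * x k)"
  unfolding in_l1_def by (simp add: abs_mult summable_mult)

lemma in_l1_divide: "in_l1 x \<Longrightarrow> in_l1 (\<lambda>k. x k / c)"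
  using in_l1_cmult[of x "1 / c"] by simp

lemma in_l1_add:
  assumes "in_l1 x" "in_l1 y"
  shows "in_l1 (\<lambda>k. x k + y k)"
  using in_l1_diff[OF assms(1) in_l1_cmult[OF assms(2), of "-1"]] by simp

lemma abs_suminf_mult_le_l1norm:
  assumes "in_l1 x" "\<And>k. \<bar>w k\<bar> \<le> 1"
  shows "\<bar>\<Sum>k. w k * x k\<bar> \<le> l1norm x"
proof -
  have s: "summable (\<lambda>k. \<bar>w k * x k\<bar>)"
    using in_l1_mult[OF assms] by (simp add: in_l1_def)
  have "\<bar>\<Sum>k. w k * x k\<bar> \<le> (\<Sum>k. \<bar>w k * x k\<bar>)"
    by (rule summable_rabs[OF s])
  also have "\<dots> \<le> l1norm x"
    unfolding l1norm_def
  proof (rule suminf_le[OF _ s])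
    show "\<bar>w k * x k\<bar> \<le> \<bar>x k\<bar>" for k
      using mult_right_mono[OF assms(2)[of k], of "\<bar>x k\<bar>"] by (simp add: abs_mult)
    show "summable (\<lambda>k. \<bar>x k\<bar>)"
      using assms(1) by (simp add: in_l1_def)
  qed
  finally show ?thesis .
qed

lemma prob_seq_in_l1: "prob_seq p \<Longrightarrow> in_l1 p"
  by (simp add: prob_seq_def in_l1_def)

subsection \<open>Crossover as a self-convolution of averaged tails\<close>

definition pgf :: "(nat \<Rightarrow> real) \<Rightarrow> real \<Rightarrow> real" where
  "pgf x z = (\<Sum>k. x k * z ^ k)"

definition av :: "(nat \<Rightarrow> real) \<Rightarrow> nat \<Rightarrow> real" where
  "av x j = (\<Sum>k. x (k + j) / real (k + j + 1))"

lemma abs_power_le_one: "0 \<le> z \<Longrightarrow> z \<le> 1 \<Longrightarrow> \<bar>z ^ k\<bar> \<le> (1::real)"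
  by (simp add: power_le_one)

lemma in_l1_mult_power:
  assumes "in_l1 x" "0 \<le> z" "z \<le> 1"
  shows "in_l1 (\<lambda>k. x k * z ^ k)"
  using in_l1_mult[OF assms(1) abs_power_le_one[OF assms(2,3)]] by (simp add: mult.commute)

lemma sums_pgf:
  assumes "in_l1 x" "0 \<le> z" "z \<le> 1"
  shows "(\<lambda>k. x k * z ^ k) sums pgf x z"
  unfolding pgf_def using in_l1_imp_summable[OF in_l1_mult_power[OF assms]] by (rule summable_sums)

lemma pgf_diff:
  assumes "in_l1 x" "in_l1 y" "0 \<le> z" "z \<le> 1"
  shows "pgf (\<lambda>k. x k - y k) z = pgf x z - pgf y z"
  using sums_unique[OF sums_diff[OF sums_pgf[OF assms(1,3,4)] sums_pgf[OF assms(2,3,4)]]]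
  unfolding pgf_def by (simp add: algebra_simps)

lemma pgf_1: "pgf x 1 = (\<Sum>k. x k)"
  by (simp add: pgf_def)

lemma pgf_nonneg:
  assumes "in_l1 x" "\<And>k. 0 \<le> x k" "0 \<le> z" "z \<le> 1"
  shows "0 \<le> pgf x z"
  unfolding pgf_def
  using in_l1_imp_summable[OF in_l1_mult_power[OF assms(1,3,4)]] assms by (intro suminf_nonneg) auto

lemma pgf_le_pgf_1:
  assumes "in_l1 x" "\<And>k. 0 \<le> x k" "0 \<le> z" "z \<le> 1"
  shows "pgf x z \<le> pgf x 1"
  unfolding pgf_def
proof (rule suminf_le)
  show "x k * z ^ k \<le> x k * 1 ^ k" for k
    using assms by (intro mult_left_mono) (auto simp: power_le_one)
  show "summable (\<lambda>k. x k * z ^ k)" "summable (\<lambda>k. x k * 1 ^ k)"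
    using assms by (auto intro!: in_l1_imp_summable in_l1_mult_power)
qed

lemma in_l1_div_Suc:
  assumes "in_l1 x"
  shows "in_l1 (\<lambda>k. x k / real (k + 1))"
  using in_l1_mult[OF assms, of "\<lambda>k. 1 / real (k + 1)"] by simp

lemma has_sum_av:
  assumes "in_l1 x"
  shows "((\<lambda>k. x k / real (k + 1)) has_sum av x j) {j..}"
proof -
  let ?f = "\<lambda>k. x k / real (k + 1)"
  have "summable (\<lambda>k. \<bar>?f (k + j)\<bar>)"
    using in_l1_div_Suc[OF assms] summable_iff_shift[of "\<lambda>k. \<bar>?f k\<bar>" j] by (simp add: in_l1_def)
  hence "((\<lambda>k. ?f (k + j)) has_sum av x j) UNIV"
    unfolding av_def using summable_sums[OF summable_rabs_cancel]
    by (intro norm_summable_imp_has_sum) auto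
  moreover have "range (\<lambda>k. k + j) = {j..}"
    by (auto simp: image_iff intro: le_add_diff_inverse2[symmetric])
  ultimately show ?thesis
    using has_sum_reindex[of "\<lambda>k. k + j" UNIV ?f "av x j"] by (simp add: o_def)
qed

lemma av_diff:
  assumes "in_l1 x" "in_l1 y"
  shows "av (\<lambda>k. x k - y k) j = av x j - av y j"
proof -
  have "((\<lambda>k. (x k - y k) / real (k + 1)) has_sum av x j - av y j) {j..}"
    using has_sum_add[OF has_sum_av[OF assms(1)] has_sum_cmult_right[OF has_sum_av[OF assms(2)], of "-1"], of j]
    by (simp add: diff_divide_distrib)
  thus ?thesis
    using has_sum_av[OF in_l1_diff[OF assms]] has_sum_unique by blast
qed

lemma av_nonneg:
  assumes "in_l1 x" "\<And>k. 0 \<le> x k"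
  shows "0 \<le> av x j"
  using has_sum_nonneg[OF has_sum_av[OF assms(1)]] assms(2) by simp

text \<open>The weight \<open>1 + min {k, l, i, k + l - i}\<close> counts the ways to write \<open>i\<close> as a sum of
  an element of \<open>{0..k}\<close> and an element of \<open>{0..l}\<close>.\<close>

lemma card_crossover_splits:
  assumes "i \<le> k + (l::nat)"
  shows "card {j. j \<le> i \<and> j \<le> k \<and> i - j \<le> l} = 1 + min (min k l) (min i (k + l - i))"
proof -
  have "{j. j \<le> i \<and> j \<le> k \<and> i - j \<le> l} = {i - l..min i k}"
    by auto
  thus ?thesis
    using assms by auto
qed

lemma has_sum_finite_sum:
  fixes f :: "'b \<Rightarrow> 'a \<Rightarrow> real"
  assumes "finite I" "\<And>j. j \<in> I \<Longrightarrow> (f j has_sum s j) A"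
  shows "((\<lambda>x. \<Sum>j\<in>I. f j x) has_sum (\<Sum>j\<in>I. s j)) A"
  using assms by (induction I rule: finite_induct) (auto intro: has_sum_add)

lemma R1_eq_convolution:
  assumes "in_l1 x"
  shows "R1 x i = (\<Sum>j\<le>i. av x j * av x (i - j))"
proof -
  let ?f = "\<lambda>k. x k / real (k + 1)"
  let ?S = "{(k, l). i \<le> k + l}"
  let ?g = "\<lambda>j (k, l). if j \<le> k \<and> i - j \<le> l then ?f k * ?f l else 0"
  have *: "(?g j has_sum av x j * av x (i - j)) ?S" if "j \<le> i" for j
  proof -
    have n: "(\<lambda>k. norm (?f k)) summable_on {a..}" for a
      using has_sum_imp_summable[OF has_sum_av[OF assms, of a]]
      by (subst summable_on_iff_abs_summable_on_real[symmetric])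
    have "((\<lambda>(k, l). ?f k * ?f l) has_sum av x j * av x (i - j)) ({j..} \<times> {i - j..})"
    proof (rule has_sum_SigmaI)
      show "((\<lambda>l. (case (k, l) of (k, l) \<Rightarrow> ?f k * ?f l)) has_sum ?f k * av x (i - j)) {i - j..}" for k
        using has_sum_cmult_right[OF has_sum_av[OF assms], of "?f k" "i - j"] by simp
      show "((\<lambda>k. ?f k * av x (i - j)) has_sum av x j * av x (i - j)) {j..}"
        using has_sum_cmult_left[OF has_sum_av[OF assms]] by simp
      show "(\<lambda>(k, l). ?f k * ?f l) summable_on ({j..} \<times> {i - j..})"
      proof (rule abs_summable_summable, rule summable_on_SigmaI)
        show "((\<lambda>l. norm (case (k, l) of (k, l) \<Rightarrow> ?f k * ?f l))
            has_sum norm (?f k) * (\<Sum>\<^sub>\<infinity>l\<in>{i - j..}. norm (?f l))) {i - j..}" for k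
          using has_sum_cmult_right[OF has_sum_infsum[OF n], of "norm (?f k)" "i - j"]
          by (simp add: abs_mult)
        show "(\<lambda>k. norm (?f k) * (\<Sum>\<^sub>\<infinity>l\<in>{i - j..}. norm (?f l))) summable_on {j..}"
          using n by (rule summable_on_cmult_left)
      qed auto
    qed
    thus ?thesis
      using that by (subst has_sum_cong_neutral[where g = "\<lambda>(k, l). ?f k * ?f l" and T = "{j..} \<times> {i - j..}"])
        (auto split: if_splits)
  qed
  have "((\<lambda>y. \<Sum>j\<le>i. ?g j y) has_sum (\<Sum>j\<le>i. av x j * av x (i - j))) ?S"
    using * by (intro has_sum_finite_sum) auto
  moreover have "(\<Sum>j\<le>i. ?g j y) = (case y of (k, l) \<Rightarrow>
      (1 + real (min (min k l) (min i (k + l - i)))) / (real (k + 1) * real (l + 1)) * x k * x l)"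
    if "y \<in> ?S" for y
  proof -
    obtain k l where y: "y = (k, l)" by (cases y)
    have "(\<Sum>j\<le>i. ?g j y) = (\<Sum>j\<in>{j\<in>{..i}. j \<le> k \<and> i - j \<le> l}. ?f k * ?f l)"
      unfolding y prod.case by (rule sum.inter_filter[symmetric]) simp
    also have "\<dots> = real (card {j. j \<le> i \<and> j \<le> k \<and> i - j \<le> l}) * (?f k * ?f l)"
      by simp
    finally show ?thesis
      using that unfolding y by (subst (asm) card_crossover_splits) auto
  qed
  ultimately have "((\<lambda>(k, l). (1 + real (min (min k l) (min i (k + l - i)))) /
      (real (k + 1) * real (l + 1)) * x k * x l) has_sum (\<Sum>j\<le>i. av x j * av x (i - j))) ?S"
    by (subst has_sum_cong[symmetric]) auto
  thus ?thesis
    unfolding R1_def by (rule infsumI)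
qed

lemma in_l1_mult_power_average:
  assumes "in_l1 x" "0 \<le> z" "z \<le> 1"
  shows "in_l1 (\<lambda>k. x k / real (k + 1) * (\<Sum>j\<le>k. z ^ j))"
proof -
  have "\<bar>(\<Sum>j\<le>k. z ^ j) / real (k + 1)\<bar> \<le> 1" for k
  proof -
    have "(\<Sum>j\<le>k. z ^ j) \<le> (\<Sum>j\<le>k. 1)"
      using assms by (intro sum_mono) (auto simp: power_le_one)
    moreover have "0 \<le> (\<Sum>j\<le>k. z ^ j)"
      using assms by (intro sum_nonneg) auto
    ultimately show ?thesis by simp
  qed
  from in_l1_mult[OF assms(1) this] show ?thesis
    by (simp add: field_simps)
qed

lemma av_sums_power:
  assumes "in_l1 x" "0 \<le> z" "z \<le> 1"
  shows "(\<lambda>j. av x j * z ^ j) sums (\<Sum>k. x k / real (k + 1) * (\<Sum>j\<le>k. z ^ j))"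
    and "in_l1 (av x)"
proof -
  let ?f = "\<lambda>k. x k / real (k + 1)"
  have key: "((\<lambda>j. av y j * w ^ j) has_sum (\<Sum>k. y k / real (k + 1) * (\<Sum>j\<le>k. w ^ j))) UNIV"
    if y: "in_l1 y" and w: "0 \<le> w" "w \<le> 1" for y and w :: real
  proof -
    let ?h = "\<lambda>y k. y k / real (k + 1) * (\<Sum>j\<le>k. w ^ j)"
    let ?g = "\<lambda>(k, j). y k / real (k + 1) * w ^ j"
    have h: "in_l1 (?h y)"
      using in_l1_mult_power_average[OF y w] .
    have S: "?g summable_on (Sigma UNIV (\<lambda>k. {..k}))"
    proof (rule abs_summable_summable)
      have "(\<lambda>k. \<bar>?h y k\<bar>) summable_on UNIV"
        using h by (intro summable_nonneg_imp_summable_on) (auto simp: in_l1_def)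
      thus "(\<lambda>p. norm (?g p)) summable_on (Sigma UNIV (\<lambda>k. {..k}))"
        using w by (intro summable_on_SigmaI[where g = "\<lambda>k. \<bar>?h y k\<bar>"])
          (auto intro!: has_sum_finiteI simp: abs_mult sum_distrib_left[symmetric] sum_nonneg sum_divide_distrib[symmetric])
    qed
    have "(?g has_sum (\<Sum>k. ?h y k)) (Sigma UNIV (\<lambda>k. {..k}))"
    proof (rule has_sum_SigmaI[OF _ _ S])
      show "((\<lambda>j. ?g (k, j)) has_sum ?h y k) {..k}" for k
        by (intro has_sum_finiteI) (auto simp: sum_distrib_left)
      show "(?h y has_sum (\<Sum>k. ?h y k)) UNIV"
        using h by (intro norm_summable_imp_has_sum summable_sums in_l1_imp_summable)
          (auto simp: in_l1_def)
    qed
    hence "((\<lambda>(j, k). ?g (k, j)) has_sum (\<Sum>k. ?h y k)) (Sigma UNIV (\<lambda>j. {j..}))"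
      by (subst has_sum_reindex_bij_witness[where j = "\<lambda>(j, k). (k, j)" and i = "\<lambda>(k, j). (j, k)"]) auto
    thus ?thesis
    proof (rule has_sum_SigmaD)
      show "((\<lambda>k. (\<lambda>(j, k). ?g (k, j)) (j, k)) has_sum av y j * w ^ j) {j..}" for j
        using has_sum_cmult_left[OF has_sum_av[OF y]] by simp
    qed
  qed
  show "(\<lambda>j. av x j * z ^ j) sums (\<Sum>k. ?f k * (\<Sum>j\<le>k. z ^ j))"
    using key[OF assms] by (rule has_sum_imp_sums)
  have "(\<lambda>j. av x j * 1 ^ j) summable_on UNIV"
    using key[OF assms(1), of 1] has_sum_imp_summable by fastforce
  thus "in_l1 (av x)"
    using summable_on_iff_abs_summable_on_real[of "av x" UNIV] summable_on_imp_summable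
    by (auto simp: in_l1_def)
qed

lemmas in_l1_av = av_sums_power(2)[OF _ order.refl zero_le_one]

lemma pgf_av:
  assumes "in_l1 x" "0 \<le> z" "z \<le> 1"
  shows "pgf (av x) z = (\<Sum>k. x k / real (k + 1) * (\<Sum>j\<le>k. z ^ j))"
  using av_sums_power(1)[OF assms] unfolding pgf_def by (rule sums_unique[symmetric])

lemma pgf_av_1: "in_l1 x \<Longrightarrow> pgf (av x) 1 = pgf x 1"
  by (subst pgf_av) (auto simp: pgf_1)

lemma convolution_sums:
  assumes "in_l1 a" "in_l1 b" "0 \<le> z" "z \<le> 1"
  shows "(\<lambda>i. (\<Sum>j\<le>i. a j * b (i - j)) * z ^ i) sums (pgf a z * pgf b z)"
proof -
  have "(\<lambda>i. \<Sum>j\<le>i. (a j * z ^ j) * (b (i - j) * z ^ (i - j))) sums (pgf a z * pgf b z)"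
    unfolding pgf_def using assms in_l1_mult_power
    by (intro Cauchy_product_sums) (auto simp: in_l1_def)
  moreover have "(\<Sum>j\<le>i. (a j * z ^ j) * (b (i - j) * z ^ (i - j))) = (\<Sum>j\<le>i. a j * b (i - j)) * z ^ i" for i
    unfolding sum_distrib_right
    by (intro sum.cong refl) (simp add: power_add[symmetric] mult.assoc mult.left_commute)
  ultimately show ?thesis by simp
qed

lemma pgf_R1:
  assumes "in_l1 x" "0 \<le> z" "z \<le> 1"
  shows "pgf (R1 x) z = (pgf (av x) z)\<^sup>2"
  using sums_unique[OF convolution_sums[OF in_l1_av in_l1_av assms(2,3), OF assms(1) assms(1)]]
  by (simp add: pgf_def R1_eq_convolution[OF assms(1)] power2_eq_square)

lemma in_l1_convolution:
  assumes "in_l1 a" "in_l1 b"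
  shows "in_l1 (\<lambda>i. \<Sum>j\<le>i. a j * b (i - j))"
  unfolding in_l1_def
proof (rule summable_comparison_test'[where N = 0])
  show "summable (\<lambda>i. \<Sum>j\<le>i. \<bar>a j\<bar> * \<bar>b (i - j)\<bar>)"
    using convolution_sums[of "\<lambda>k. \<bar>a k\<bar>" "\<lambda>k. \<bar>b k\<bar>" 1] assms
    by (auto simp: in_l1_def sums_iff)
  show "norm \<bar>\<Sum>j\<le>i. a j * b (i - j)\<bar> \<le> (\<Sum>j\<le>i. \<bar>a j\<bar> * \<bar>b (i - j)\<bar>)" for i
    by (simp add: sum_abs[THEN order_trans] abs_mult)
qed

lemma in_l1_R1: "in_l1 x \<Longrightarrow> in_l1 (R1 x)"
  using in_l1_convolution[OF in_l1_av in_l1_av, of x x] by (simp add: R1_eq_convolution in_l1_def)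

lemma prob_seq_R1:
  assumes "prob_seq p"
  shows "prob_seq (R1 p)"
proof -
  have l1: "in_l1 p" using assms by (rule prob_seq_in_l1)
  have "0 \<le> R1 p i" for i
    using assms l1 by (auto simp: R1_eq_convolution prob_seq_def intro!: sum_nonneg mult_nonneg_nonneg av_nonneg)
  moreover have "(\<Sum>i. R1 p i) = 1"
    using pgf_R1[OF l1, of 1] assms unfolding pgf_av_1[OF l1] by (simp add: pgf_1 prob_seq_def)
  ultimately show ?thesis
    using in_l1_imp_summable[OF in_l1_R1[OF l1]] by (simp add: prob_seq_def)
qed

subsection \<open>Contraction of generating functions\<close>

lemma has_derivative_pgf_antiderivative:
  assumes "in_l1 x" "0 < z" "z < 1"
  shows "((\<lambda>z. \<Sum>k. x k / real (k + 1) * z ^ (k + 1)) has_real_derivative pgf x z) (at z)"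
proof -
  have "((\<lambda>z. \<Sum>k. x k / real (k + 1) * z ^ Suc k) has_real_derivative
      (\<Sum>k. x k / real (k + 1) * real (Suc k) * z ^ k)) (at z)"
  proof (rule DERIV_power_series'[where R = 1])
    fix y :: real assume "y \<in> {-1<..<1}"
    hence "in_l1 (\<lambda>k. y ^ k * x k)"
      using assms(1) by (intro in_l1_mult) (auto simp: power_abs intro!: power_le_one)
    thus "summable (\<lambda>k. x k / real (k + 1) * real (Suc k) * y ^ k)"
      using in_l1_imp_summable[of "\<lambda>k. y ^ k * x k"] by (simp add: mult.commute)
  qed (use assms in auto)
  thus ?thesis
    by (simp add: pgf_def)
qed

lemma continuous_on_pgf_antiderivative:
  assumes "in_l1 x"
  shows "continuous_on {0..1} (\<lambda>z::real. \<Sum>k. x k / real (k + 1) * z ^ (k + 1))"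
proof (rule uniform_limit_theorem)
  show "uniform_limit {0..1} (\<lambda>n z. \<Sum>k<n. x k / real (k + 1) * z ^ (k + 1))
      (\<lambda>z::real. \<Sum>k. x k / real (k + 1) * z ^ (k + 1)) sequentially"
  proof (rule Weierstrass_m_test)
    show "summable (\<lambda>k. \<bar>x k / real (k + 1)\<bar>)"
      using in_l1_div_Suc[OF assms] by (simp add: in_l1_def)
    show "norm (x k / real (k + 1) * z ^ (k + 1)) \<le> \<bar>x k / real (k + 1)\<bar>" if "z \<in> {0..1}" for k and z :: real
      using that mult_left_le[of "\<bar>z ^ (k + 1)\<bar>" "\<bar>x k / real (k + 1)\<bar>"] abs_power_le_one[of z "k + 1"]
      by (simp only: real_norm_def abs_mult) simp
  qed
qed (auto intro!: always_eventually continuous_intros)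

text \<open>\<open>pgf (av x) z\<close> is the average of \<open>pgf x\<close> over the interval from \<open>z\<close> to 1.\<close>

lemma pgf_av_eq_average:
  assumes "in_l1 x" "0 \<le> z" "z \<le> 1"
  shows "(1 - z) * pgf (av x) z =
    (\<Sum>k. x k / real (k + 1) * 1 ^ (k + 1)) - (\<Sum>k. x k / real (k + 1) * z ^ (k + 1))"
proof -
  have s: "summable (\<lambda>k. x k / real (k + 1) * w ^ (k + 1))" if "0 \<le> w" "w \<le> 1" for w
    using in_l1_imp_summable[OF in_l1_mult[OF in_l1_div_Suc[OF assms(1)] abs_power_le_one[OF that], of Suc]]
    by (simp add: mult.commute)
  have g: "(1 - z) * (\<Sum>j\<le>k. z ^ j) = 1 ^ (k + 1) - z ^ (k + 1)" for k
    by (simp add: sum_gp_basic)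
  have "(1 - z) * pgf (av x) z = (\<Sum>k. (1 - z) * (x k / real (k + 1) * (\<Sum>j\<le>k. z ^ j)))"
    unfolding pgf_av[OF assms]
    by (rule suminf_mult[symmetric, OF in_l1_imp_summable[OF in_l1_mult_power_average[OF assms]]])
  also have "\<dots> = (\<Sum>k. x k / real (k + 1) * 1 ^ (k + 1) - x k / real (k + 1) * z ^ (k + 1))"
    unfolding right_diff_distrib[symmetric] g[symmetric] by (simp add: mult.left_commute)
  also have "\<dots> = (\<Sum>k. x k / real (k + 1) * 1 ^ (k + 1)) - (\<Sum>k. x k / real (k + 1) * z ^ (k + 1))"
    using s[of 1] s[of z] assms by (intro suminf_diff[symmetric]) auto
  finally show ?thesis .
qed

lemma pgf_av_le:
  assumes x: "in_l1 x"
    and bound: "\<And>y. 0 < y \<Longrightarrow> y < 1 \<Longrightarrow> pgf x y \<le> D * (1 - y)\<^sup>2 + E"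
    and z: "0 \<le> z" "z < 1"
  shows "pgf (av x) z \<le> D / 3 * (1 - z)\<^sup>2 + E"
proof -
  define H where "H = (\<lambda>z::real. \<Sum>k. x k / real (k + 1) * z ^ (k + 1))"
  let ?f = "\<lambda>y. H y + (D / 3 * (1 - y) ^ 3 + E * (1 - y))"
  have "?f 1 \<le> ?f z"
  proof (rule DERIV_nonpos_imp_decreasing_open[where f = ?f])
    show "\<exists>d. (?f has_real_derivative d) (at y) \<and> d \<le> 0" if "z < y" "y < 1" for y
    proof (intro exI conjI)
      show "(?f has_real_derivative (pgf x y - (D * (1 - y)\<^sup>2 + E))) (at y)"
        using has_derivative_pgf_antiderivative[OF x, of y] that z unfolding H_def[symmetric]
        by (auto intro!: derivative_eq_intros)
      show "pgf x y - (D * (1 - y)\<^sup>2 + E) \<le> 0"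
        using bound[of y] that z by auto
    qed
    have "continuous_on {z..1} H"
      unfolding H_def using z by (intro continuous_on_subset[OF continuous_on_pgf_antiderivative[OF x]]) auto
    thus "continuous_on {z..1} ?f"
      by (intro continuous_intros)
  qed (use z in auto)
  hence "H 1 - H z \<le> (1 - z) * (D / 3 * (1 - z)\<^sup>2 + E)"
    by (simp add: field_simps power3_eq_cube power2_eq_square)
  hence "(1 - z) * pgf (av x) z \<le> (1 - z) * (D / 3 * (1 - z)\<^sup>2 + E)"
    using pgf_av_eq_average[OF x, of z] z by (simp add: H_def)
  thus ?thesis
    using z by simp
qed

lemma abs_pgf_av_diff_le:
  assumes "in_l1 p" "in_l1 q"
    and bound: "\<And>y. 0 \<le> y \<Longrightarrow> y < 1 \<Longrightarrow> \<bar>pgf p y - pgf q y\<bar> \<le> D * (1 - y)\<^sup>2 + E"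
    and z: "0 \<le> z" "z < 1"
  shows "\<bar>pgf (av p) z - pgf (av q) z\<bar> \<le> D / 3 * (1 - z)\<^sup>2 + E"
proof -
  have *: "pgf (av x) z - pgf (av y) z \<le> D / 3 * (1 - z)\<^sup>2 + E"
    if "in_l1 x" "in_l1 y" "\<And>w. 0 \<le> w \<Longrightarrow> w < 1 \<Longrightarrow> pgf x w - pgf y w \<le> D * (1 - w)\<^sup>2 + E" for x y
  proof -
    have "pgf (av (\<lambda>k. x k - y k)) z \<le> D / 3 * (1 - z)\<^sup>2 + E"
      using that z by (intro pgf_av_le in_l1_diff) (auto simp: pgf_diff)
    moreover have "av (\<lambda>k. x k - y k) = (\<lambda>j. av x j - av y j)"
      using av_diff[OF that(1,2)] by blast
    ultimately show ?thesis
      using z that by (simp add: pgf_diff in_l1_av)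
  qed
  show ?thesis
    using *[of p q] *[of q p] assms by (fastforce simp: abs_le_iff)
qed

lemma pgf_prob_bounds:
  assumes "prob_seq p" "0 \<le> z" "z \<le> 1"
  shows "0 \<le> pgf p z" "pgf p z \<le> 1"
  using pgf_nonneg[of p z] pgf_le_pgf_1[of p z] prob_seq_in_l1[OF assms(1)] assms
  by (auto simp: prob_seq_def pgf_1)

lemma prob_seq_av:
  assumes "prob_seq p"
  shows "prob_seq (av p)"
  using assms pgf_av_1[of p] prob_seq_in_l1[OF assms] av_nonneg[of p]
    in_l1_imp_summable[OF in_l1_av[of p]]
  by (auto simp: prob_seq_def pgf_1)

text \<open>The additive error \<open>E\<close> will be the term \<open>(2 t)^n / n!\<close> of the continuous-time induction.\<close>

lemma pgf_R1_contraction: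
  assumes "prob_seq p" "prob_seq q"
    and "\<And>y. 0 \<le> y \<Longrightarrow> y < 1 \<Longrightarrow> \<bar>pgf p y - pgf q y\<bar> \<le> D * (1 - y)\<^sup>2 + E"
    and z: "0 \<le> z" "z < 1"
  shows "\<bar>pgf (R1 p) z - pgf (R1 q) z\<bar> \<le> 2 / 3 * D * (1 - z)\<^sup>2 + 2 * E"
proof -
  note l1 = assms(1,2)[THEN prob_seq_in_l1]
  let ?a = "pgf (av p) z" and ?b = "pgf (av q) z"
  have b: "0 \<le> ?a" "?a \<le> 1" "0 \<le> ?b" "?b \<le> 1"
    using pgf_prob_bounds prob_seq_av assms by auto
  have "\<bar>pgf (R1 p) z - pgf (R1 q) z\<bar> = \<bar>?a + ?b\<bar> * \<bar>?a - ?b\<bar>"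
    using z by (simp add: pgf_R1[OF l1(1)] pgf_R1[OF l1(2)] abs_mult[symmetric] algebra_simps power2_eq_square)
  also have "\<dots> \<le> 2 * \<bar>?a - ?b\<bar>"
    using b by (intro mult_right_mono) auto
  also have "\<dots> \<le> 2 * (D / 3 * (1 - z)\<^sup>2 + E)"
    using abs_pgf_av_diff_le[OF l1 assms(3) z] by simp
  finally show ?thesis by simp
qed

subsection \<open>From generating functions to the l1 norm\<close>

lemma suminf_split_head:
  fixes f :: "nat \<Rightarrow> real"
  assumes "summable f"
  shows "suminf f = (\<Sum>k<K. f k) + (\<Sum>k. f (k + K))"
  using suminf_split_initial_segment[OF assms, of K] by simp

lemma pgf_tail:
  assumes "prob_seq p" "0 < z" "z \<le> 1"
  shows "p k \<le> (pgf p z - (\<Sum>j<k. p j * z ^ j)) / z ^ k"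
    and "(pgf p z - (\<Sum>j<k. p j * z ^ j)) / z ^ k \<le> p k + z"
proof -
  have l1: "in_l1 p" using assms(1) by (rule prob_seq_in_l1)
  have s: "summable (\<lambda>j. p j * z ^ j)"
    using in_l1_imp_summable[OF in_l1_mult_power[OF l1]] assms by auto
  have nn: "0 \<le> p j" for j using assms(1) by (simp add: prob_seq_def)
  have sp: "summable p" and sp1: "suminf p = 1" using assms(1) by (auto simp: prob_seq_def)
  have eq: "pgf p z - (\<Sum>j<k. p j * z ^ j) = p k * z ^ k + (\<Sum>j. p (j + Suc k) * z ^ (j + Suc k))"
    using suminf_split_head[OF s, of "Suc k"] by (simp add: pgf_def)
  have sS: "summable (\<lambda>j. p (j + Suc k) * z ^ (j + Suc k))"
    using s by (subst summable_iff_shift)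
  have "0 \<le> (\<Sum>j. p (j + Suc k) * z ^ (j + Suc k))"
    using nn assms sS by (intro suminf_nonneg) auto
  thus "p k \<le> (pgf p z - (\<Sum>j<k. p j * z ^ j)) / z ^ k"
    unfolding eq using assms by (simp add: field_simps)
  have s1: "summable (\<lambda>j. p (j + Suc k))"
    using sp by (subst summable_iff_shift)
  have "(\<Sum>j. p (j + Suc k) * z ^ (j + Suc k)) \<le> (\<Sum>j. p (j + Suc k) * z ^ Suc k)"
  proof (rule suminf_le[OF _ sS summable_mult2[OF s1]])
    show "p (j + Suc k) * z ^ (j + Suc k) \<le> p (j + Suc k) * z ^ Suc k" for j
      using assms nn by (intro mult_left_mono power_decreasing) auto
  qed
  also have "\<dots> = (\<Sum>j. p (j + Suc k)) * z ^ Suc k"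
    using suminf_mult2[OF s1] by simp
  also have "\<dots> \<le> 1 * z ^ Suc k"
  proof (rule mult_right_mono)
    show "(\<Sum>j. p (j + Suc k)) \<le> 1"
      using suminf_split_head[OF sp, of "Suc k"] sum_nonneg[of "{..<Suc k}" p] nn sp1 by simp
  qed (use assms in auto)
  finally show "(pgf p z - (\<Sum>j<k. p j * z ^ j)) / z ^ k \<le> p k + z"
    unfolding eq using assms by (simp add: field_simps)
qed

lemma coeff_tendsto_of_pgf_tendsto:
  assumes P: "\<forall>\<^sub>F t in F. prob_seq (P t)" and q: "prob_seq q"
    and lim: "\<And>z. 0 < z \<Longrightarrow> z < 1 \<Longrightarrow> ((\<lambda>t. pgf (P t) z) \<longlongrightarrow> pgf q z) F"
  shows "((\<lambda>t. P t k) \<longlongrightarrow> q k) F"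
proof (induction k rule: less_induct)
  case (less k)
  show ?case
  proof (rule tendstoI)
    fix e :: real assume "0 < e"
    define z where "z = min (e / 2) (1 / 2)"
    have z: "0 < z" "z < 1" "z \<le> e / 2" using \<open>0 < e\<close> by (auto simp: z_def)
    let ?T = "\<lambda>p. (pgf p z - (\<Sum>j<k. p j * z ^ j)) / z ^ k"
    have "((\<lambda>t. ?T (P t)) \<longlongrightarrow> ?T q) F"
      using z less lim[OF z(1,2)] by (intro tendsto_intros) auto
    hence "\<forall>\<^sub>F t in F. dist (?T (P t)) (?T q) < e / 2"
      using \<open>0 < e\<close> by (intro tendstoD) auto
    with P show "\<forall>\<^sub>F t in F. dist (P t k) (q k) < e"
    proof eventually_elim
      case (elim t)
      show ?case
        using elim(2) pgf_tail[OF elim(1), of z k] pgf_tail[OF q, of z k] z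
        unfolding dist_real_def abs_less_iff by linarith
    qed
  qed
qed

lemma l1norm_diff_le:
  assumes "prob_seq p" "prob_seq q"
  shows "l1norm (\<lambda>k. p k - q k) \<le> 2 * (\<Sum>k<K. \<bar>p k - q k\<bar>) + 2 * (\<Sum>k. q (k + K))"
proof -
  note l1 = assms[THEN prob_seq_in_l1]
  have s: "summable p" "summable q" "summable (\<lambda>k. \<bar>p k - q k\<bar>)" and nn: "\<And>k. 0 \<le> p k" "\<And>k. 0 \<le> q k"
    and 1: "suminf p = 1" "suminf q = 1"
    using assms in_l1_diff[OF l1] by (auto simp: prob_seq_def in_l1_def)
  have sK: "summable (\<lambda>k. p (k + K))" "summable (\<lambda>k. q (k + K))" "summable (\<lambda>k. \<bar>p (k + K) - q (k + K)\<bar>)"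
    using s summable_iff_shift[of p K] summable_iff_shift[of q K] summable_iff_shift[of "\<lambda>k. \<bar>p k - q k\<bar>" K] by auto
  have "l1norm (\<lambda>k. p k - q k) = (\<Sum>k<K. \<bar>p k - q k\<bar>) + (\<Sum>k. \<bar>p (k + K) - q (k + K)\<bar>)"
    unfolding l1norm_def by (rule suminf_split_head[OF s(3)])
  also have "(\<Sum>k. \<bar>p (k + K) - q (k + K)\<bar>) \<le> (\<Sum>k. p (k + K) + q (k + K))"
    using sK nn by (intro suminf_le summable_add) (auto simp: abs_le_iff intro: add_increasing add_increasing2)
  also have "\<dots> = (\<Sum>k. p (k + K)) + (\<Sum>k. q (k + K))"
    using sK by (intro suminf_add[symmetric])
  also have "(\<Sum>k. p (k + K)) = (\<Sum>k. q (k + K)) + (\<Sum>k<K. q k - p k)"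
    using suminf_split_head[OF s(1), of K] suminf_split_head[OF s(2), of K] 1 by (simp add: sum_subtractf)
  also have "(\<Sum>k<K. q k - p k) \<le> (\<Sum>k<K. \<bar>p k - q k\<bar>)"
    by (intro sum_mono) auto
  finally show ?thesis by simp
qed

lemma l1_tendsto_of_pgf_tendsto:
  assumes P: "\<forall>\<^sub>F t in F. prob_seq (P t)" and q: "prob_seq q"
    and lim: "\<And>z. 0 < z \<Longrightarrow> z < 1 \<Longrightarrow> ((\<lambda>t. pgf (P t) z) \<longlongrightarrow> pgf q z) F"
  shows "((\<lambda>t. l1norm (\<lambda>k. P t k - q k)) \<longlongrightarrow> 0) F"
proof (rule tendstoI)
  fix e :: real assume "0 < e"
  have "(\<lambda>K. \<Sum>k. q (k + K)) \<longlonglongrightarrow> 0"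
    using q by (intro suminf_exist_split2) (auto simp: prob_seq_def)
  hence "\<forall>\<^sub>F K in sequentially. \<bar>\<Sum>k. q (k + K)\<bar> < e / 4"
    using tendstoD[of _ 0 sequentially "e / 4"] \<open>0 < e\<close> unfolding dist_real_def by fastforce
  then obtain K where K: "\<bar>\<Sum>k. q (k + K)\<bar> < e / 4"
    using eventually_happens by fastforce
  have "((\<lambda>t. \<Sum>k<K. \<bar>P t k - q k\<bar>) \<longlongrightarrow> (\<Sum>k<K. \<bar>q k - q k\<bar>)) F"
    by (intro tendsto_intros coeff_tendsto_of_pgf_tendsto[OF assms])
  hence "\<forall>\<^sub>F t in F. \<bar>\<Sum>k<K. \<bar>P t k - q k\<bar>\<bar> < e / 4"
    using tendstoD[of "\<lambda>t. \<Sum>k<K. \<bar>P t k - q k\<bar>" 0 F "e / 4"] \<open>0 < e\<close> by (simp add: dist_real_def)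
  with P show "\<forall>\<^sub>F t in F. dist (l1norm (\<lambda>k. P t k - q k)) 0 < e"
  proof eventually_elim
    case (elim t)
    have "0 \<le> l1norm (\<lambda>k. P t k - q k)"
      unfolding l1norm_def using in_l1_diff[OF elim(1)[THEN prob_seq_in_l1] prob_seq_in_l1[OF q]]
      by (intro suminf_nonneg) (auto simp: in_l1_def)
    thus ?case
      using l1norm_diff_le[OF elim(1) q, of K] elim(2) K by (simp add: dist_real_def)
  qed
qed

subsection \<open>Moments and the limit distribution\<close>

lemma summable_power_times_geometric:
  fixes r :: real
  assumes "norm r < 1"
  shows "summable (\<lambda>k. real k ^ n * r ^ k)"
  using assms
proof (induction n arbitrary: r)
  case 0
  thus ?case by simp
next
  case (Suc n)
  have "summable (\<lambda>k. diffs (\<lambda>k. real k ^ n) k * r ^ k)"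
    using Suc by (intro termdiff_converges[where K = 1]) auto
  hence "summable (\<lambda>k. real (Suc k) ^ Suc n * r ^ k * r)"
    by (intro summable_mult2) (simp add: diffs_def)
  hence "summable (\<lambda>k. real (Suc k) ^ Suc n * r ^ Suc k)"
    by (simp only: mult.assoc power_Suc2)
  thus ?case
    by (subst (asm) summable_Suc_iff)
qed

lemma summable_second_moment:
  assumes "\<And>k. 0 \<le> p k" "limsup (\<lambda>k. ereal (root k (p k))) < 1"
  shows "summable (\<lambda>k. (real k)\<^sup>2 * p k)"
proof -
  obtain r where r: "limsup (\<lambda>k. ereal (root k (p k))) < ereal r" "r < 1"
    using assms(2) ereal_dense2[OF assms(2)] by (auto simp: one_ereal_def)
  have ev: "\<forall>\<^sub>F k in sequentially. root k (p k) < r"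
    using Limsup_lessD[OF r(1)] by simp
  then obtain k0 where k0: "\<And>k. k \<ge> k0 \<Longrightarrow> root k (p k) < r"
    by (auto simp: eventually_sequentially)
  have r0: "0 \<le> r"
    using k0[of k0] real_root_ge_zero[OF assms(1)[of k0], of k0] by simp
  show ?thesis
  proof (rule summable_comparison_test'[where N = "Suc k0"])
    show "summable (\<lambda>k. real k ^ 2 * r ^ k)"
      using r0 r(2) by (intro summable_power_times_geometric) auto
    fix k assume k: "Suc k0 \<le> k"
    have "p k = root k (p k) ^ k"
      using k assms(1) by simp
    also have "\<dots> \<le> r ^ k"
      using k k0[of k] assms(1) by (intro power_mono) auto
    finally show "norm ((real k)\<^sup>2 * p k) \<le> real k ^ 2 * r ^ k"
      using assms(1)[of k] by (auto simp: abs_mult intro!: mult_left_mono)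
  qed
qed

lemma power_second_order_bounds:
  fixes z :: real
  assumes "0 \<le> z" "z \<le> 1"
  shows "0 \<le> z ^ k - 1 + real k * (1 - z)"
    and "z ^ k - 1 + real k * (1 - z) \<le> (real k)\<^sup>2 * (1 - z)\<^sup>2"
proof -
  have "0 \<le> z ^ k - 1 + real k * (1 - z) \<and> z ^ k - 1 + real k * (1 - z) \<le> (real k)\<^sup>2 * (1 - z)\<^sup>2"
  proof (induction k)
    case 0
    show ?case by simp
  next
    case (Suc k)
    let ?e = "z ^ k - 1 + real k * (1 - z)"
    have eq: "z ^ Suc k - 1 + real (Suc k) * (1 - z) = z * ?e + real k * (1 - z)\<^sup>2"
      by (simp add: algebra_simps power2_eq_square)
    have 1: "z * ?e \<le> 1 * ?e"
      using Suc assms by (intro mult_right_mono) auto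
    have 2: "(real k)\<^sup>2 * (1 - z)\<^sup>2 + real k * (1 - z)\<^sup>2 \<le> (real (Suc k))\<^sup>2 * (1 - z)\<^sup>2"
      unfolding distrib_right[symmetric] by (rule mult_right_mono) (simp add: power2_eq_square algebra_simps, simp)
    have 3: "0 \<le> z * ?e" "0 \<le> real k * (1 - z)\<^sup>2"
      using Suc assms by auto
    have "0 \<le> a + c \<and> a + c \<le> d"
      if "a \<le> 1 * e" "b + c \<le> d" "0 \<le> a" "0 \<le> c" "e \<le> b" for a b c d e :: real
      using that by auto
    from this[OF 1 2 3 Suc[THEN conjunct2]] show ?case
      unfolding eq .
  qed
  thus "0 \<le> z ^ k - 1 + real k * (1 - z)"
    "z ^ k - 1 + real k * (1 - z) \<le> (real k)\<^sup>2 * (1 - z)\<^sup>2" by auto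
qed

lemma summable_mean:
  assumes "\<And>k. 0 \<le> p k" "summable (\<lambda>k. (real k)\<^sup>2 * p k)"
  shows "summable (\<lambda>k. real k * p k)"
proof (rule summable_comparison_test'[where N = 0, OF assms(2)])
  show "norm (real k * p k) \<le> (real k)\<^sup>2 * p k" for k
  proof -
    have "real k \<le> (real k)\<^sup>2"
      by (cases k) (auto simp: power2_eq_square)
    thus ?thesis
      using assms(1)[of k] by (auto simp: abs_mult intro!: mult_right_mono)
  qed
qed

lemma pgf_second_order_bounds:
  assumes "prob_seq p" "summable (\<lambda>k. (real k)\<^sup>2 * p k)" "0 \<le> z" "z \<le> 1"
  shows "0 \<le> pgf p z - 1 + (\<Sum>k. real k * p k) * (1 - z)"
    and "pgf p z - 1 + (\<Sum>k. real k * p k) * (1 - z) \<le> (\<Sum>k. (real k)\<^sup>2 * p k) * (1 - z)\<^sup>2"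
proof -
  have nn: "\<And>k. 0 \<le> p k" and p: "p sums 1"
    using assms(1) by (auto simp: prob_seq_def sums_iff)
  have "(\<lambda>k. p k * z ^ k - p k + real k * p k * (1 - z)) sums
      (pgf p z - 1 + (\<Sum>k. real k * p k) * (1 - z))"
    using sums_pgf[OF prob_seq_in_l1[OF assms(1)] assms(3,4)] p
    by (intro sums_add sums_diff sums_mult2 summable_sums summable_mean nn assms)
  hence s: "(\<lambda>k. p k * (z ^ k - 1 + real k * (1 - z))) sums
      (pgf p z - 1 + (\<Sum>k. real k * p k) * (1 - z))"
    by (simp add: algebra_simps)
  have t: "(\<lambda>k. p k * ((real k)\<^sup>2 * (1 - z)\<^sup>2)) sums ((\<Sum>k. (real k)\<^sup>2 * p k) * (1 - z)\<^sup>2)"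
    using sums_mult2[OF summable_sums[OF assms(2)], of "(1 - z)\<^sup>2"] by (simp add: ac_simps)
  show "0 \<le> pgf p z - 1 + (\<Sum>k. real k * p k) * (1 - z)"
    using nn power_second_order_bounds(1)[OF assms(3,4)]
    by (intro sums_le[OF _ sums_zero s] mult_nonneg_nonneg) auto
  show "pgf p z - 1 + (\<Sum>k. real k * p k) * (1 - z) \<le> (\<Sum>k. (real k)\<^sup>2 * p k) * (1 - z)\<^sup>2"
    using nn power_second_order_bounds(2)[OF assms(3,4)]
    by (intro sums_le[OF _ s t] mult_left_mono) auto
qed

lemma abs_pgf_diff_le_of_equal_means:
  assumes "prob_seq p" "summable (\<lambda>k. (real k)\<^sup>2 * p k)"
    and "prob_seq q" "summable (\<lambda>k. (real k)\<^sup>2 * q k)"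
    and "(\<Sum>k. real k * p k) = (\<Sum>k. real k * q k)" "0 \<le> z" "z \<le> 1"
  shows "\<bar>pgf p z - pgf q z\<bar> \<le> ((\<Sum>k. (real k)\<^sup>2 * p k) + (\<Sum>k. (real k)\<^sup>2 * q k)) * (1 - z)\<^sup>2"
  using pgf_second_order_bounds[OF assms(1,2,6,7)] pgf_second_order_bounds[OF assms(3,4,6,7)] assms(5)
  unfolding abs_le_iff distrib_right by simp

lemma limit_dist_ratio:
  assumes "0 \<le> (m::real)"
  shows "norm (m / (m + 2)) < 1" "1 - m / (m + 2) = 2 / (m + 2)"
  using assms by (auto simp: field_simps)

lemma prob_seq_limit_dist:
  assumes "0 \<le> m"
  shows "prob_seq (limit_dist m)"
proof -
  let ?r = "m / (m + 2)"
  have "(\<lambda>k. real (Suc k) * ?r ^ k) sums (1 / (1 - ?r)\<^sup>2)"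
    by (rule geometric_deriv_sums[OF limit_dist_ratio(1)[OF assms]])
  hence "(\<lambda>k. (2 / (m + 2))\<^sup>2 * (real (Suc k) * ?r ^ k)) sums ((2 / (m + 2))\<^sup>2 * (1 / (2 / (m + 2))\<^sup>2))"
    unfolding limit_dist_ratio(2)[OF assms] by (rule sums_mult)
  hence "limit_dist m sums 1"
    using assms by (simp add: limit_dist_def[abs_def] mult.assoc)
  moreover have "0 \<le> limit_dist m k" for k
    using assms by (simp add: limit_dist_def)
  ultimately show ?thesis
    by (auto simp: prob_seq_def sums_iff)
qed

lemma av_limit_dist:
  assumes "0 \<le> m"
  shows "av (limit_dist m) j = 2 / (m + 2) * (m / (m + 2)) ^ j"
proof -
  let ?r = "m / (m + 2)" and ?c = "2 / (m + 2)"
  have "(\<lambda>k. ?r ^ k) sums (1 / ?c)"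
    using geometric_sums[OF limit_dist_ratio(1)[OF assms]] unfolding limit_dist_ratio(2)[OF assms] .
  hence "(\<lambda>k. ?c\<^sup>2 * ?r ^ j * ?r ^ k) sums (?c\<^sup>2 * ?r ^ j * (1 / ?c))"
    by (rule sums_mult)
  moreover have "limit_dist m (k + j) / real (k + j + 1) = ?c\<^sup>2 * ?r ^ j * ?r ^ k" for k
  proof -
    have "a * b * c / b = a * c" if "b \<noteq> 0" for a b c :: real
      using that by simp
    from this[of "real (k + j + 1)" "?c\<^sup>2" "?r ^ (k + j)"] show ?thesis
      unfolding limit_dist_def by (simp only: of_nat_eq_0_iff power_add) (simp add: ac_simps)
  qed
  moreover have "c\<^sup>2 * x * (1 / c) = c * x" if "c \<noteq> 0" for c x :: real
    using that by (simp add: power2_eq_square)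
  from this[of ?c "?r ^ j"] have "?c\<^sup>2 * ?r ^ j * (1 / ?c) = ?c * ?r ^ j"
    using assms by (simp only: divide_eq_0_iff) linarith
  ultimately show ?thesis
    unfolding av_def by (simp add: sums_iff)
qed

lemma R1_limit_dist:
  assumes "0 \<le> m"
  shows "R1 (limit_dist m) = limit_dist m"
proof
  fix i
  let ?r = "m / (m + 2)" and ?c = "2 / (m + 2)"
  have "R1 (limit_dist m) i = (\<Sum>j\<le>i. (?c * ?r ^ j) * (?c * ?r ^ (i - j)))"
    using R1_eq_convolution[OF prob_seq_in_l1[OF prob_seq_limit_dist[OF assms]]] av_limit_dist[OF assms] by simp
  also have "\<dots> = (\<Sum>j\<le>i. ?c\<^sup>2 * ?r ^ i)"
  proof (rule sum.cong[OF refl])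
    fix j assume "j \<in> {..i}"
    hence "?r ^ i = ?r ^ j * ?r ^ (i - j)"
      by (simp add: power_add[symmetric])
    thus "(?c * ?r ^ j) * (?c * ?r ^ (i - j)) = ?c\<^sup>2 * ?r ^ i"
      by (simp add: power2_eq_square)
  qed
  finally show "R1 (limit_dist m) i = limit_dist m i"
    by (simp add: limit_dist_def)
qed

lemma summable_second_moment_limit_dist:
  assumes "0 \<le> m"
  shows "summable (\<lambda>k. (real k)\<^sup>2 * limit_dist m k)"
proof -
  let ?r = "m / (m + 2)" and ?c = "2 / (m + 2)"
  have "summable (\<lambda>k. ?c\<^sup>2 * (real k ^ 3 * ?r ^ k + real k ^ 2 * ?r ^ k))"
    by (intro summable_mult summable_add summable_power_times_geometric limit_dist_ratio assms)
  moreover have "?c\<^sup>2 * (real k ^ 3 * ?r ^ k + real k ^ 2 * ?r ^ k) = (real k)\<^sup>2 * limit_dist m k" for k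
  proof -
    have "a * (K ^ 3 * x + K ^ 2 * x) = K\<^sup>2 * (a * (K + 1) * x)" for a K x :: real
      by (simp add: algebra_simps power3_eq_cube power2_eq_square)
    from this[of "?c\<^sup>2" "real k" "?r ^ k"] show ?thesis
      unfolding limit_dist_def by (simp only: of_nat_add of_nat_1)
  qed
  ultimately show ?thesis by simp
qed

lemma mean_limit_dist:
  assumes "0 \<le> m"
  shows "(\<Sum>k. real k * limit_dist m k) = m"
proof -
  let ?r = "m / (m + 2)" and ?c = "2 / (m + 2)"
  have r: "norm ?r < 1" by (rule limit_dist_ratio(1)[OF assms])
  have "(\<lambda>k. \<Sum>i\<le>k. (real (Suc i) * ?r ^ i) * ?r ^ (k - i)) sums
      ((\<Sum>k. real (Suc k) * ?r ^ k) * (\<Sum>k. ?r ^ k))"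
  proof (rule Cauchy_product_sums)
    show "summable (\<lambda>k. norm (real (Suc k) * ?r ^ k))"
      using sums_summable[OF geometric_deriv_sums[OF r]] assms by (simp add: abs_mult)
    show "summable (\<lambda>k. norm (?r ^ k))"
      unfolding norm_power by (rule summable_geometric) (simp only: real_norm_def abs_abs r[unfolded real_norm_def])
  qed
  also have "(\<Sum>k. real (Suc k) * ?r ^ k) = 1 / ?c\<^sup>2"
    using sums_unique[OF geometric_deriv_sums[OF r]] limit_dist_ratio(2)[OF assms] by simp
  also have "(\<Sum>k. ?r ^ k) = 1 / ?c"
    using suminf_geometric[OF r] limit_dist_ratio(2)[OF assms] by simp
  finally have 1: "(\<lambda>k. \<Sum>i\<le>k. (real (Suc i) * ?r ^ i) * ?r ^ (k - i)) sums (1 / ?c\<^sup>2 * (1 / ?c))" .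
  have 2: "(\<Sum>i\<le>k. (real (Suc i) * ?r ^ i) * ?r ^ (k - i)) = real (Suc k) * real (Suc (Suc k)) / 2 * ?r ^ k" for k
  proof -
    have "(\<Sum>i\<le>k. (real (Suc i) * ?r ^ i) * ?r ^ (k - i)) = (\<Sum>i\<le>k. real (Suc i) * ?r ^ k)"
    proof (rule sum.cong[OF refl])
      fix i assume "i \<in> {..k}"
      hence "?r ^ k = ?r ^ i * ?r ^ (k - i)"
        by (simp add: power_add[symmetric])
      thus "(real (Suc i) * ?r ^ i) * ?r ^ (k - i) = real (Suc i) * ?r ^ k"
        by simp
    qed
    also have "\<dots> = (\<Sum>i\<le>k. real (Suc i)) * ?r ^ k"
      by (rule sum_distrib_right[symmetric])
    also have "(\<Sum>i\<le>k. real (Suc i)) = real (Suc k) * real (Suc (Suc k)) / 2"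
      by (induction k) (auto simp: field_simps)
    finally show ?thesis .
  qed
  have "(\<lambda>k. ?c\<^sup>2 * ?r * 2 * (real (Suc k) * real (Suc (Suc k)) / 2 * ?r ^ k)) sums
      (?c\<^sup>2 * ?r * 2 * (1 / ?c\<^sup>2 * (1 / ?c)))"
    using 1 unfolding 2 by (rule sums_mult)
  moreover have "?c\<^sup>2 * ?r * 2 * (real (Suc k) * real (Suc (Suc k)) / 2 * ?r ^ k) = real (Suc k) * limit_dist m (Suc k)" for k
  proof -
    have "a * r * 2 * (A * B / 2 * x) = A * (a * B * (r * x))" for a r A B x :: real
      by simp
    from this[of "?c\<^sup>2" ?r "real (Suc k)" "real (Suc (Suc k))" "?r ^ k"] show ?thesis
      unfolding limit_dist_def power_Suc by (simp only: Suc_eq_plus1)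
  qed
  moreover have "?c\<^sup>2 * ?r * 2 * (1 / ?c\<^sup>2 * (1 / ?c)) = m"
  proof -
    have "a\<^sup>2 * r * 2 * (1 / a\<^sup>2 * (1 / a)) = 2 * r / a" if "a \<noteq> 0" for a r :: real
      using that by simp
    moreover have "?c \<noteq> 0" "2 * ?r / ?c = m"
      using assms by auto
    ultimately show ?thesis by (simp only: not_False_eq_True)
  qed
  ultimately have "(\<lambda>k. real (Suc k) * limit_dist m (Suc k)) sums m"
    by simp
  hence "(\<lambda>k. real k * limit_dist m k) sums m"
    using sums_Suc_iff[of "\<lambda>k. real k * limit_dist m k" m] by simp
  thus ?thesis by (rule sums_unique[symmetric])
qed

subsection \<open>The continuous-time flow\<close>

lemma l1norm_nonneg: "in_l1 x \<Longrightarrow> 0 \<le> l1norm x"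
  unfolding l1norm_def in_l1_def by (rule suminf_nonneg) auto

lemma l1norm_add_le:
  assumes "in_l1 x" "in_l1 y"
  shows "l1norm (\<lambda>k. x k + y k) \<le> l1norm x + l1norm y"
proof -
  have s: "summable (\<lambda>k. \<bar>x k\<bar>)" "summable (\<lambda>k. \<bar>y k\<bar>)" "summable (\<lambda>k. \<bar>x k + y k\<bar>)"
    using assms in_l1_add[OF assms] by (auto simp: in_l1_def)
  show ?thesis
    unfolding l1norm_def suminf_add[OF s(1,2)]
    using s by (intro suminf_le summable_add) auto
qed

lemma l1norm_cmult: "in_l1 x \<Longrightarrow> l1norm (\<lambda>k. c * x k) = \<bar>c\<bar> * l1norm x"
  unfolding l1norm_def in_l1_def abs_mult by (rule suminf_mult)

lemma has_derivative_weighted_sum: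
  assumes D: "has_l1_derivative P D t" "in_l1 D"
    and P: "\<And>s. 0 \<le> s \<Longrightarrow> in_l1 (P s)" and t: "0 \<le> t" and w: "\<And>k. \<bar>w k\<bar> \<le> 1"
  shows "((\<lambda>s. \<Sum>k. w k * P s k) has_real_derivative (\<Sum>k. w k * D k)) (at t within {0..})"
proof -
  let ?f = "\<lambda>s. \<Sum>k. w k * P s k"
  let ?q = "\<lambda>s k. (P s k - P t k) / (s - t) - D k"
  have sm: "summable (\<lambda>k. w k * x k)" if "in_l1 x" for x
    by (rule in_l1_imp_summable[OF in_l1_mult[OF that w]])
  have "norm ((?f s - ?f t) / (s - t) - (\<Sum>k. w k * D k)) \<le> l1norm (?q s)" if "0 \<le> s" for s
  proof -
    have "(\<lambda>k. (w k * P s k - w k * P t k) / (s - t) - w k * D k) sums ((?f s - ?f t) / (s - t) - (\<Sum>k. w k * D k))"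
      by (intro sums_diff sums_divide summable_sums sm D(2) P that t)
    hence "(?f s - ?f t) / (s - t) - (\<Sum>k. w k * D k) = (\<Sum>k. w k * ?q s k)"
      by (simp add: sums_iff right_diff_distrib)
    moreover have "in_l1 (?q s)"
      by (intro in_l1_diff in_l1_divide D(2) P that t)
    ultimately show ?thesis
      using abs_suminf_mult_le_l1norm[of "?q s" w, OF _ w] by simp
  qed
  hence "\<forall>\<^sub>F s in at t within {0..}. norm ((?f s - ?f t) / (s - t) - (\<Sum>k. w k * D k)) \<le> l1norm (?q s)"
    by (auto simp: eventually_at_filter)
  hence "((\<lambda>s. (?f s - ?f t) / (s - t) - (\<Sum>k. w k * D k)) \<longlongrightarrow> 0) (at t within {0..})"
    using D(1) unfolding has_l1_derivative_def by (rule Lim_null_comparison)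
  thus ?thesis
    unfolding has_field_derivative_iff by (rule LIM_zero_cancel)
qed

lemma continuous_l1norm:
  assumes D: "has_l1_derivative P D t" "in_l1 D"
    and P: "\<And>s. 0 \<le> s \<Longrightarrow> in_l1 (P s)" and t: "0 \<le> t"
  shows "((\<lambda>s. l1norm (P s)) \<longlongrightarrow> l1norm (P t)) (at t within {0..})"
proof -
  let ?q = "\<lambda>s k. (P s k - P t k) / (s - t) - D k"
  have "norm (l1norm (P s) - l1norm (P t)) \<le> \<bar>s - t\<bar> * (l1norm (?q s) + l1norm D)"
    if "0 \<le> s" "s \<noteq> t" for s
  proof -
    have q: "in_l1 (?q s)"
      by (intro in_l1_diff in_l1_divide D(2) P that t)
    let ?d = "\<lambda>k. (s - t) * (?q s k + D k)"
    have d: "in_l1 ?d"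
      by (intro in_l1_cmult in_l1_add q D(2))
    have eq: "P s = (\<lambda>k. P t k + ?d k)" "P t = (\<lambda>k. P s k + - 1 * ?d k)"
      using that(2) by auto
    have "l1norm (P s) \<le> l1norm (P t) + l1norm ?d"
      by (subst eq(1)) (rule l1norm_add_le[OF P[OF t] d])
    moreover have "l1norm (P t) \<le> l1norm (P s) + l1norm (\<lambda>k. - 1 * ?d k)"
      by (subst eq(2)) (rule l1norm_add_le[OF P[OF that(1)] in_l1_cmult[OF d]])
    moreover have "l1norm (\<lambda>k. - 1 * ?d k) = l1norm ?d"
      using l1norm_cmult[OF d, of "- 1"] by simp
    moreover have "l1norm ?d = \<bar>s - t\<bar> * l1norm (\<lambda>k. ?q s k + D k)"
      by (rule l1norm_cmult[OF in_l1_add[OF q D(2)]])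
    moreover have "\<dots> \<le> \<bar>s - t\<bar> * (l1norm (?q s) + l1norm D)"
      by (intro mult_left_mono l1norm_add_le q D(2)) auto
    ultimately show ?thesis by simp
  qed
  hence le: "\<forall>\<^sub>F s in at t within {0..}. norm (l1norm (P s) - l1norm (P t)) \<le> \<bar>s - t\<bar> * (l1norm (?q s) + l1norm D)"
    by (auto simp: eventually_at_filter)
  have "((\<lambda>s. \<bar>s - t\<bar> * (l1norm (?q s) + l1norm D)) \<longlongrightarrow> \<bar>t - t\<bar> * (0 + l1norm D)) (at t within {0..})"
    using D(1) unfolding has_l1_derivative_def by (intro tendsto_intros)
  hence "((\<lambda>s. l1norm (P s) - l1norm (P t)) \<longlongrightarrow> 0) (at t within {0..})"
    by (intro Lim_null_comparison[OF le]) simp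
  thus ?thesis by (rule LIM_zero_cancel)
qed

lemma nonpos_of_derivative_le:
  fixes f f' :: "real \<Rightarrow> real"
  assumes "0 \<le> T"
    and f': "\<And>t. 0 \<le> t \<Longrightarrow> t \<le> T \<Longrightarrow> (f has_real_derivative f' t) (at t within {0..})"
    and le: "\<And>t. 0 \<le> t \<Longrightarrow> t \<le> T \<Longrightarrow> f' t \<le> c * f t"
    and "f 0 \<le> 0"
  shows "f T \<le> 0"
proof -
  let ?g = "\<lambda>t. exp (- c * t) * f t"
  have g': "(?g has_real_derivative exp (- c * t) * (f' t - c * f t)) (at t within {0..})"
    if "0 \<le> t" "t \<le> T" for t
    using f'[OF that] by (auto intro!: derivative_eq_intros simp: algebra_simps)
  have "?g T \<le> ?g 0"
  proof (rule DERIV_nonpos_imp_decreasing_open[where f = ?g])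
    show "\<exists>y. (?g has_real_derivative y) (at t) \<and> y \<le> 0" if "0 < t" "t < T" for t
    proof (intro exI conjI)
      have "at t within {0..} = at t"
        using that by (intro at_within_interior) (auto simp: interior_real_atLeast)
      thus "(?g has_real_derivative exp (- c * t) * (f' t - c * f t)) (at t)"
        using g'[of t] that by simp
      show "exp (- c * t) * (f' t - c * f t) \<le> 0"
        using le[of t] that by (intro mult_nonneg_nonpos) auto
    qed
    show "continuous_on {0..T} ?g"
      unfolding continuous_on_eq_continuous_within
    proof
      fix t assume t: "t \<in> {0..T}"
      show "continuous (at t within {0..T}) ?g"
        using DERIV_continuous[OF DERIV_subset[OF g'[of t], of "{0..T}"]] t by simp
    qed
  qed (use assms in auto)
  also have "\<dots> \<le> 0" using assms(4) by simp
  finally show ?thesis by (simp add: mult_le_0_iff)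
qed

lemma has_derivative_power_over_fact:
  "((\<lambda>s. (c * s) ^ Suc n / fact (Suc n)) has_real_derivative c * ((c * t) ^ n / fact n)) (at t within A)"
proof -
  have "((\<lambda>s. (c * s) ^ Suc n / fact (Suc n)) has_real_derivative
      (real (Suc n) * (c * (c * t) ^ n)) / fact (Suc n)) (at t within A)"
    by (auto intro!: derivative_eq_intros simp del: fact_Suc power_Suc of_nat_Suc)
  thus ?thesis
    by (simp add: fact_Suc del: of_nat_Suc)
qed

lemma power_over_fact_tendsto_0: "(\<lambda>n. (x::real) ^ n / fact n) \<longlonglongrightarrow> 0"
  using summable_LIMSEQ_zero[OF summable_exp[of x]] by (simp add: field_simps)

lemma sum_R1_ge:
  assumes x: "in_l1 x" and "finite F"
  shows "(\<Sum>i\<in>F. R1 x i) \<ge> - (2 * l1norm x * (\<Sum>k. max 0 (- x k)))"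
proof -
  define u v where "u = (\<lambda>k. max 0 (x k))" and "v = (\<lambda>k. max 0 (- x k))"
  have "summable (\<lambda>k. \<bar>x k\<bar>)"
    using x by (simp add: in_l1_def)
  hence l1: "in_l1 u" "in_l1 v"
    unfolding in_l1_def u_def v_def
    by (rule summable_comparison_test'[where N = 0 and g = "\<lambda>k. \<bar>x k\<bar>"], simp)+
  have nn: "0 \<le> u k" "0 \<le> v k" for k by (auto simp: u_def v_def)
  note a = in_l1_av[OF l1(1)] in_l1_av[OF l1(2)]
  have ann: "0 \<le> av u j" "0 \<le> av v j" for j
    using av_nonneg l1 nn by auto
  have av: "av x j = av u j - av v j" for j
  proof -
    have "x = (\<lambda>k. u k - v k)" by (auto simp: u_def v_def)
    thus ?thesis using av_diff[OF l1] by metis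
  qed
  have conv: "(\<Sum>i\<in>F. \<Sum>j\<le>i. av y j * av y' (i - j)) \<le> pgf y 1 * pgf y' 1"
    if "in_l1 y" "in_l1 y'" "\<And>j. 0 \<le> av y j" "\<And>j. 0 \<le> av y' j" for y y'
  proof -
    have "(\<lambda>i. \<Sum>j\<le>i. av y j * av y' (i - j)) sums (pgf y 1 * pgf y' 1)"
      using convolution_sums[OF in_l1_av in_l1_av, of y y' 1] that by (simp add: pgf_av_1)
    thus ?thesis
      using that \<open>finite F\<close> sum_le_suminf[of "\<lambda>i. \<Sum>j\<le>i. av y j * av y' (i - j)" F]
      by (auto simp: sums_iff sum_nonneg)
  qed
  have "R1 x i \<ge> - ((\<Sum>j\<le>i. av u j * av v (i - j)) + (\<Sum>j\<le>i. av v j * av u (i - j)))" for i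
  proof -
    have "- ((\<Sum>j\<le>i. av u j * av v (i - j)) + (\<Sum>j\<le>i. av v j * av u (i - j))) =
        (\<Sum>j\<le>i. - (av u j * av v (i - j) + av v j * av u (i - j)))"
      by (simp add: sum_subtractf sum_negf)
    also have "\<dots> \<le> (\<Sum>j\<le>i. av x j * av x (i - j))"
    proof (rule sum_mono)
      fix j
      have "0 \<le> av u j * av u (i - j)" "0 \<le> av v j * av v (i - j)"
        using ann by auto
      thus "- (av u j * av v (i - j) + av v j * av u (i - j)) \<le> av x j * av x (i - j)"
        unfolding av by (simp add: algebra_simps)
    qed
    finally show ?thesis
      by (simp add: R1_eq_convolution[OF x])
  qed
  hence "(\<Sum>i\<in>F. R1 x i) \<ge> (\<Sum>i\<in>F. - ((\<Sum>j\<le>i. av u j * av v (i - j)) + (\<Sum>j\<le>i. av v j * av u (i - j))))"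
    by (intro sum_mono)
  moreover have "(\<Sum>i\<in>F. - ((\<Sum>j\<le>i. av u j * av v (i - j)) + (\<Sum>j\<le>i. av v j * av u (i - j)))) \<ge>
      - (2 * (pgf u 1 * pgf v 1))"
    using conv[OF l1 ann] conv[OF l1(2,1) ann(2,1)] unfolding sum_negf sum.distrib
    by (simp add: mult.commute[of "pgf v 1"])
  moreover have "pgf u 1 * pgf v 1 \<le> l1norm x * pgf v 1"
  proof (rule mult_right_mono)
    show "pgf u 1 \<le> l1norm x"
      unfolding pgf_1 l1norm_def using in_l1_imp_summable[OF l1(1)] x
      by (intro suminf_le) (auto simp: u_def in_l1_def)
    show "0 \<le> pgf v 1"
      using pgf_nonneg[OF l1(2) nn(2)] by simp
  qed
  ultimately show ?thesis
    by (simp add: pgf_1 v_def)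
qed

locale crossover_flow =
  fixes P :: "real \<Rightarrow> nat \<Rightarrow> real"
  assumes in_l1: "0 \<le> t \<Longrightarrow> in_l1 (P t)"
    and has_l1_derivative: "0 \<le> t \<Longrightarrow> has_l1_derivative P (\<lambda>k. R1 (P t) k - P t k) t"
    and prob_seq_init: "prob_seq (P 0)"
begin

lemma in_l1_rhs: "0 \<le> t \<Longrightarrow> in_l1 (\<lambda>k. R1 (P t) k - P t k)"
  by (intro in_l1_diff in_l1_R1 in_l1)

lemma has_derivative_pgf:
  assumes "0 \<le> t" "0 \<le> z" "z \<le> 1"
  shows "((\<lambda>s. pgf (P s) z) has_real_derivative pgf (R1 (P t)) z - pgf (P t) z) (at t within {0..})"
  using has_derivative_weighted_sum[OF has_l1_derivative in_l1_rhs in_l1 assms(1),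
      of "\<lambda>k. z ^ k"] assms abs_power_le_one[of z] pgf_diff[OF in_l1_R1 in_l1, of "P t" t z] in_l1
  by (simp add: pgf_def mult.commute)

lemma has_derivative_finite_sum:
  assumes "0 \<le> t" "finite F"
  shows "((\<lambda>s. \<Sum>k\<in>F. P s k) has_real_derivative (\<Sum>k\<in>F. R1 (P t) k - P t k)) (at t within {0..})"
proof -
  have "(\<Sum>k. indicator F k * x k) = (\<Sum>k\<in>F. x k)" for x :: "nat \<Rightarrow> real"
    using assms(2) by (subst suminf_finite[of F]) (auto simp: indicator_def)
  thus ?thesis
    using has_derivative_weighted_sum[OF has_l1_derivative in_l1_rhs in_l1 assms(1),
      of "indicator F"] assms(1) by (simp add: indicator_def)
qed

lemma l1norm_bounded:
  assumes "0 \<le> T"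
  obtains M where "0 \<le> M" "\<And>t. 0 \<le> t \<Longrightarrow> t \<le> T \<Longrightarrow> l1norm (P t) \<le> M"
proof -
  have "continuous_on {0..T} (\<lambda>t. l1norm (P t))"
    unfolding continuous_on_def
    using tendsto_within_subset[OF continuous_l1norm[OF has_l1_derivative in_l1_rhs in_l1], of _ "{0..T}"]
    by auto
  hence "compact ((\<lambda>t. l1norm (P t)) ` {0..T})"
    by (intro compact_continuous_image) auto
  hence "bounded ((\<lambda>t. l1norm (P t)) ` {0..T})"
    by (rule compact_imp_bounded)
  then obtain M where "\<forall>x \<in> (\<lambda>t. l1norm (P t)) ` {0..T}. \<bar>x\<bar> \<le> M"
    unfolding bounded_real by blast
  hence M: "\<bar>l1norm (P t)\<bar> \<le> M" if "t \<in> {0..T}" for t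
    using that by blast
  show thesis
  proof (rule that)
    show "0 \<le> M" using M[of 0] assms by auto
    show "l1norm (P t) \<le> M" if "0 \<le> t" "t \<le> T" for t
      using M[of t] that by auto
  qed
qed

lemma summable_negative_part: "0 \<le> t \<Longrightarrow> summable (\<lambda>k. max 0 (- P t k))"
  using in_l1[of t] unfolding in_l1_def
  by (intro summable_comparison_test'[where N = 0 and g = "\<lambda>k. \<bar>P t k\<bar>" and f = "\<lambda>k. max 0 (- P t k)"]) auto

text \<open>Each pass of this Picard-type induction integrates the differential inequality for the
  mass of the negative part once more.\<close>

lemma negative_part_le:
  assumes "0 \<le> M" and M: "\<And>t. 0 \<le> t \<Longrightarrow> t \<le> T \<Longrightarrow> l1norm (P t) \<le> M"
    and "0 \<le> t" "t \<le> T"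
  shows "(\<Sum>k. max 0 (- P t k)) \<le> M * ((2 * M * t) ^ n / fact n)"
  using assms(3,4)
proof (induction n arbitrary: t)
  case 0
  have "(\<Sum>k. max 0 (- P t k)) \<le> l1norm (P t)"
    unfolding l1norm_def using 0 in_l1[of t] summable_negative_part[of t]
    by (intro suminf_le) (auto simp: in_l1_def)
  thus ?case using M[OF 0] by simp
next
  case (Suc n)
  let ?B = "\<lambda>n s. M * ((2 * M * s) ^ n / fact n)"
  have *: "- (\<Sum>k\<in>F. P t k) \<le> ?B (Suc n) t" if F: "finite F" for F
  proof -
    let ?f = "\<lambda>s. - (\<Sum>k\<in>F. P s k) - ?B (Suc n) s"
    have "?f t \<le> 0"
    proof (rule nonpos_of_derivative_le[where f = ?f and c = "- 1"])
      fix s assume s: "0 \<le> s" "s \<le> t"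
      show "(?f has_real_derivative - (\<Sum>k\<in>F. R1 (P s) k - P s k) - M * (2 * M * ((2 * M * s) ^ n / fact n)))
          (at s within {0..})"
        by (intro DERIV_diff DERIV_minus DERIV_cmult has_derivative_power_over_fact has_derivative_finite_sum s F)
      have "2 * l1norm (P s) * (\<Sum>k. max 0 (- P s k)) \<le> 2 * M * ?B n s"
        using Suc s M[of s] Suc.IH[of s] \<open>0 \<le> M\<close> l1norm_nonneg[OF in_l1[OF s(1)]]
        by (intro mult_mono) (auto intro!: suminf_nonneg summable_negative_part)
      moreover have "0 \<le> ?B (Suc n) s"
        using \<open>0 \<le> M\<close> s by (intro mult_nonneg_nonneg divide_nonneg_nonneg zero_le_power) auto
      ultimately show "- (\<Sum>k\<in>F. R1 (P s) k - P s k) - M * (2 * M * ((2 * M * s) ^ n / fact n)) \<le> - 1 * ?f s"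
        using sum_R1_ge[OF in_l1[OF s(1)] F] by (simp add: sum_subtractf algebra_simps)
    next
      show "?f 0 \<le> 0"
        using prob_seq_init by (auto simp: prob_seq_def intro!: sum_nonneg)
    qed (use Suc in auto)
    thus ?thesis by simp
  qed
  show ?case
  proof (rule suminf_le_const[OF summable_negative_part])
    fix K
    have "(\<Sum>k<K. max 0 (- P t k)) = (\<Sum>k\<in>{k\<in>{..<K}. P t k < 0}. - P t k)"
      unfolding sum.inter_filter[OF finite_lessThan] by (intro sum.cong) auto
    thus "(\<Sum>k<K. max 0 (- P t k)) \<le> ?B (Suc n) t"
      using *[of "{k\<in>{..<K}. P t k < 0}"] by (simp only: sum_negf) simp
  qed (use Suc in auto)
qed

lemma nonneg:
  assumes "0 \<le> t"
  shows "0 \<le> P t k"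
proof -
  obtain M where M: "0 \<le> M" "\<And>s. 0 \<le> s \<Longrightarrow> s \<le> t \<Longrightarrow> l1norm (P s) \<le> M"
    using l1norm_bounded[OF assms] by blast
  have "(\<lambda>n. M * ((2 * M * t) ^ n / fact n)) \<longlonglongrightarrow> M * 0"
    by (intro tendsto_mult_left power_over_fact_tendsto_0)
  hence "(\<Sum>k. max 0 (- P t k)) \<le> M * 0"
    by (rule LIMSEQ_le_const) (use negative_part_le[OF M assms order.refl] in auto)
  moreover have "max 0 (- P t k) \<le> (\<Sum>k. max 0 (- P t k))"
    using sum_le_suminf[OF summable_negative_part[OF assms], of "{k}"] by simp
  ultimately show ?thesis by simp
qed

lemma total_mass:
  assumes "0 \<le> t"
  shows "pgf (P t) 1 = 1"
proof -
  obtain M where M: "0 \<le> M" "\<And>s. 0 \<le> s \<Longrightarrow> s \<le> t \<Longrightarrow> l1norm (P s) \<le> M"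
    using l1norm_bounded[OF assms] by blast
  let ?S = "\<lambda>s. pgf (P s) 1"
  let ?f = "\<lambda>s. (?S s - 1)\<^sup>2"
  have "?f t \<le> 0"
  proof (rule nonpos_of_derivative_le[where f = ?f and c = "2 * M"])
    fix s assume s: "0 \<le> s" "s \<le> t"
    have "(?S has_real_derivative (?S s)\<^sup>2 - ?S s) (at s within {0..})"
      using has_derivative_pgf[OF s(1), of 1] pgf_R1[OF in_l1[OF s(1)], of 1] pgf_av_1[OF in_l1[OF s(1)]]
      by simp
    thus "(?f has_real_derivative 2 * ?S s * (?S s - 1)\<^sup>2) (at s within {0..})"
      by (auto intro!: derivative_eq_intros simp: power2_eq_square algebra_simps)
    have "\<bar>?S s\<bar> \<le> l1norm (P s)"
      using abs_suminf_mult_le_l1norm[OF in_l1[OF s(1)], of "\<lambda>_. 1"] by (simp add: pgf_1)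
    thus "2 * ?S s * (?S s - 1)\<^sup>2 \<le> 2 * M * ?f s"
      using M(2)[OF s] by (intro mult_right_mono) auto
  next
    show "?f 0 \<le> 0"
      using prob_seq_init by (simp add: pgf_1 prob_seq_def)
  qed (rule assms)
  thus ?thesis by simp
qed

lemma prob_seq:
  assumes "0 \<le> t"
  shows "prob_seq (P t)"
  using nonneg[OF assms] total_mass[OF assms] in_l1_imp_summable[OF in_l1[OF assms]]
  by (simp add: prob_seq_def pgf_1)

lemma pgf_diff_le:
  assumes q: "prob_seq q" "R1 q = q"
    and init: "\<And>z. 0 \<le> z \<Longrightarrow> z < 1 \<Longrightarrow> \<bar>pgf (P 0) z - pgf q z\<bar> \<le> D * (1 - z)\<^sup>2"
    and "0 \<le> D" "0 \<le> t" "0 \<le> z" "z < 1"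
  shows "\<bar>pgf (P t) z - pgf q z\<bar> \<le> D * exp (- t / 3) * (1 - z)\<^sup>2 + (2 * t) ^ n / fact n"
  using assms(5-7)
proof (induction n arbitrary: t z)
  case 0
  have "\<bar>pgf (P t) z - pgf q z\<bar> \<le> 1"
    using pgf_prob_bounds[OF prob_seq, of t z] pgf_prob_bounds[OF q(1), of z] 0 by (simp add: abs_le_iff)
  moreover have "0 \<le> D * exp (- t / 3) * (1 - z)\<^sup>2"
    using \<open>0 \<le> D\<close> by simp
  ultimately show ?case by simp
next
  case (Suc n)
  let ?E = "\<lambda>n s. (2 * s) ^ n / fact n :: real"
  let ?G = "\<lambda>s. D * exp (- s / 3) * (1 - z)\<^sup>2"
  have *: "c * (pgf (P t) z - pgf q z) - (?G t + ?E (Suc n) t) \<le> 0" if c: "\<bar>c\<bar> = 1" for c :: real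
  proof -
    let ?f = "\<lambda>s. c * (pgf (P s) z - pgf q z) - (?G s + ?E (Suc n) s)"
    show "?f t \<le> 0"
    proof (rule nonpos_of_derivative_le[where f = ?f and c = "- 1"])
      fix s assume s: "0 \<le> s" "s \<le> t"
      have G: "(?G has_real_derivative - (1 / 3) * ?G s) (at s within {0..})"
        by (auto intro!: derivative_eq_intros)
      have "((\<lambda>s. pgf (P s) z - pgf q z) has_real_derivative pgf (R1 (P s)) z - pgf (P s) z - 0) (at s within {0..})"
        using Suc s by (intro DERIV_diff has_derivative_pgf DERIV_const) auto
      from DERIV_diff[OF DERIV_cmult[OF this] DERIV_add[OF G has_derivative_power_over_fact]]
      show "(?f has_real_derivative c * (pgf (R1 (P s)) z - pgf (P s) z - 0) -
          (- (1 / 3) * ?G s + 2 * ?E n s)) (at s within {0..})" .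
      have "\<bar>pgf (R1 (P s)) z - pgf (R1 q) z\<bar> \<le> 2 / 3 * (D * exp (- s / 3)) * (1 - z)\<^sup>2 + 2 * ?E n s"
        using Suc s q by (intro pgf_R1_contraction prob_seq) auto
      moreover have "c * (pgf (R1 (P s)) z - pgf q z) \<le> \<bar>pgf (R1 (P s)) z - pgf q z\<bar>"
        using c abs_ge_self[of "c * (pgf (R1 (P s)) z - pgf q z)"] by (simp add: abs_mult)
      moreover have "0 \<le> ?E (Suc n) s"
        using s by (intro divide_nonneg_nonneg zero_le_power) auto
      ultimately show "c * (pgf (R1 (P s)) z - pgf (P s) z - 0) - (- (1 / 3) * ?G s + 2 * ?E n s) \<le> - 1 * ?f s"
        unfolding q(2) by (simp add: algebra_simps)
    next
      have "c * (pgf (P 0) z - pgf q z) \<le> \<bar>pgf (P 0) z - pgf q z\<bar>"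
        using c abs_ge_self[of "c * (pgf (P 0) z - pgf q z)"] by (simp add: abs_mult)
      thus "?f 0 \<le> 0"
        using init[of z] Suc by simp
    qed (use Suc in auto)
  qed
  show ?case
    using *[of 1] *[of "-1"] by (simp add: abs_le_iff)
qed

lemma pgf_tendsto:
  assumes q: "prob_seq q" "R1 q = q"
    and init: "\<And>z. 0 \<le> z \<Longrightarrow> z < 1 \<Longrightarrow> \<bar>pgf (P 0) z - pgf q z\<bar> \<le> D * (1 - z)\<^sup>2"
    and "0 \<le> D" "0 < z" "z < 1"
  shows "((\<lambda>t. pgf (P t) z) \<longlongrightarrow> pgf q z) at_top"
proof -
  have "\<bar>pgf (P t) z - pgf q z\<bar> \<le> D * (1 - z)\<^sup>2 * exp (- (1 / 3) * t)" if "0 \<le> t" for t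
  proof -
    have "(\<lambda>n. D * exp (- t / 3) * (1 - z)\<^sup>2 + (2 * t) ^ n / fact n) \<longlonglongrightarrow> D * exp (- t / 3) * (1 - z)\<^sup>2 + 0"
      by (intro tendsto_add tendsto_const power_over_fact_tendsto_0)
    hence "\<bar>pgf (P t) z - pgf q z\<bar> \<le> D * exp (- t / 3) * (1 - z)\<^sup>2 + 0"
      by (rule LIMSEQ_le_const) (use pgf_diff_le[OF assms(1-4) that] assms(5,6) in auto)
    thus ?thesis by (simp add: ac_simps)
  qed
  hence le: "\<forall>\<^sub>F t in at_top. norm (pgf (P t) z - pgf q z) \<le> D * (1 - z)\<^sup>2 * exp (- (1 / 3) * t)"
    by (auto simp: eventually_at_top_linorder)
  have "((\<lambda>t::real. D * (1 - z)\<^sup>2 * exp (- (1 / 3) * t)) \<longlongrightarrow> D * (1 - z)\<^sup>2 * 0) at_top"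
    by (intro tendsto_mult_left filterlim_compose[OF exp_at_bot]
        filterlim_tendsto_neg_mult_at_bot[OF tendsto_const _ filterlim_ident]) auto
  hence "((\<lambda>t. pgf (P t) z - pgf q z) \<longlongrightarrow> 0) at_top"
    by (intro Lim_null_comparison[OF le]) simp
  thus ?thesis by (rule LIM_zero_cancel)
qed

end

lemma pgf_iterate_tendsto:
  assumes P: "\<And>t. prob_seq (P t)" "\<And>t. P (Suc t) = R1 (P t)"
    and q: "prob_seq q" "R1 q = q"
    and init: "\<And>z. 0 \<le> z \<Longrightarrow> z < 1 \<Longrightarrow> \<bar>pgf (P 0) z - pgf q z\<bar> \<le> D * (1 - z)\<^sup>2"
    and z: "0 < z" "z < 1"
  shows "(\<lambda>t. pgf (P t) z) \<longlonglongrightarrow> pgf q z"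
proof -
  have *: "\<bar>pgf (P t) y - pgf q y\<bar> \<le> (2 / 3) ^ t * D * (1 - y)\<^sup>2" if "0 \<le> y" "y < 1" for t y
    using that
  proof (induction t arbitrary: y)
    case 0
    thus ?case using init by simp
  next
    case (Suc t)
    have "\<bar>pgf (R1 (P t)) y - pgf (R1 q) y\<bar> \<le> 2 / 3 * ((2 / 3) ^ t * D) * (1 - y)\<^sup>2 + 2 * 0"
      using Suc P(1) q(1) by (intro pgf_R1_contraction) auto
    thus ?case by (simp add: P(2) q(2))
  qed
  have le: "\<forall>\<^sub>F t in sequentially. norm (pgf (P t) z - pgf q z) \<le> (2 / 3) ^ t * (D * (1 - z)\<^sup>2)"
    using *[of z] z by (simp add: mult.assoc)
  have "(\<lambda>t. (2 / 3) ^ t * (D * (1 - z)\<^sup>2)) \<longlonglongrightarrow> 0 * (D * (1 - z)\<^sup>2)"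
    by (intro tendsto_mult_right LIMSEQ_power_zero) auto
  hence "(\<lambda>t. pgf (P t) z - pgf q z) \<longlonglongrightarrow> 0"
    by (intro Lim_null_comparison[OF le]) simp
  thus ?thesis by (rule LIM_zero_cancel)
qed

theorem theorem3:
  fixes p0 :: "nat \<Rightarrow> real"
  assumes "prob_seq p0"
    and "limsup (\<lambda>k. ereal (root k (p0 k))) < 1"
  shows "(\<forall>P :: nat \<Rightarrow> nat \<Rightarrow> real.
            P 0 = p0 \<and> (\<forall>t. P (Suc t) = R1 (P t)) \<longrightarrow>
            (\<lambda>t. l1norm (\<lambda>k. P t k - limit_dist (\<Sum>j. real j * p0 j) k)) \<longlonglongrightarrow> 0)
       \<and> (\<forall>P :: real \<Rightarrow> nat \<Rightarrow> real.
            P 0 = p0 \<and> (\<forall>t\<ge>0. in_l1 (P t) \<and> has_l1_derivative P (\<lambda>k. R1 (P t) k - P t k) t) \<longrightarrow>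
            ((\<lambda>t. l1norm (\<lambda>k. P t k - limit_dist (\<Sum>j. real j * p0 j) k)) \<longlongrightarrow> 0) at_top)"
proof -
  define m where "m = (\<Sum>j. real j * p0 j)"
  define q where "q = limit_dist m"
  have nn: "\<And>k. 0 \<le> p0 k"
    using assms(1) by (simp add: prob_seq_def)
  have p2: "summable (\<lambda>k. (real k)\<^sup>2 * p0 k)"
    by (rule summable_second_moment[OF nn assms(2)])
  have m: "0 \<le> m"
    unfolding m_def using nn by (intro suminf_nonneg summable_mean p2) auto
  have q: "prob_seq q" "R1 q = q"
    unfolding q_def using prob_seq_limit_dist R1_limit_dist m by auto
  have q2: "summable (\<lambda>k. (real k)\<^sup>2 * q k)"
    unfolding q_def by (rule summable_second_moment_limit_dist[OF m])
  define D where "D = (\<Sum>k. (real k)\<^sup>2 * p0 k) + (\<Sum>k. (real k)\<^sup>2 * q k)"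
  have "0 \<le> D"
    unfolding D_def using nn q(1) by (intro add_nonneg_nonneg suminf_nonneg p2 q2) (auto simp: prob_seq_def)
  have init: "\<bar>pgf p0 z - pgf q z\<bar> \<le> D * (1 - z)\<^sup>2" if "0 \<le> z" "z < 1" for z
    unfolding D_def using that mean_limit_dist[OF m]
    by (intro abs_pgf_diff_le_of_equal_means assms(1) p2 q(1) q2) (auto simp: q_def m_def)
  have "(\<lambda>t. l1norm (\<lambda>k. P t k - q k)) \<longlonglongrightarrow> 0"
    if P: "P 0 = p0" "\<And>t. P (Suc t) = R1 (P t)" for P
  proof (rule l1_tendsto_of_pgf_tendsto[OF _ q(1)])
    have prob: "prob_seq (P t)" for t
      by (induction t) (auto simp: P assms(1) prob_seq_R1)
    thus "\<forall>\<^sub>F t in sequentially. prob_seq (P t)"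
      by simp
    show "(\<lambda>t. pgf (P t) z) \<longlonglongrightarrow> pgf q z" if "0 < z" "z < 1" for z
      using prob P q init that by (intro pgf_iterate_tendsto[where P = P and D = D]) auto
  qed
  moreover have "((\<lambda>t. l1norm (\<lambda>k. P t k - q k)) \<longlongrightarrow> 0) at_top"
    if P: "P 0 = p0" "\<And>t. 0 \<le> t \<Longrightarrow> in_l1 (P t) \<and> has_l1_derivative P (\<lambda>k. R1 (P t) k - P t k) t"
    for P :: "real \<Rightarrow> nat \<Rightarrow> real"
  proof -
    interpret crossover_flow P
      by (rule crossover_flow.intro) (simp_all add: P assms(1))
    show ?thesis
    proof (rule l1_tendsto_of_pgf_tendsto[OF _ q(1)])
      show "\<forall>\<^sub>F t in at_top. prob_seq (P t)"
        using prob_seq by (auto simp: eventually_at_top_linorder)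
      show "((\<lambda>t. pgf (P t) z) \<longlongrightarrow> pgf q z) at_top" if "0 < z" "z < 1" for z
        using pgf_tendsto[OF q _ \<open>0 \<le> D\<close> that] init P(1) by simp
    qed
  qed
  ultimately show ?thesis
    unfolding q_def m_def by blast
qed

end
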